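(* Let $\ket{\chi},\ket{\delta}\in\mathbb{C}^2$ be unit vectors with $\langle\chi|\delta\rangle\neq 0$, and let $\rho_B=\ket{\chi}\bra{\chi}$ and $\sigma_B=\ket{\delta}\bra{\delta}$. Then for every real number $d$ with $0<d<1$ (however small), $$P_{\mathrm{error}}^{\mathrm{NPOVM}}(\rho_B,\sigma_B;d)\;<\;P_{\mathrm{error}}^{\mathrm{POVM}}(\rho_B,\sigma_B),$$ where $P_{\mathrm{error}}^{\mathrm{NPOVM}}(\rho_B,\sigma_B;d)$ is the minimum error over extensions without system-auxiliary entanglement and with auxiliary trace distance at most $d$, as defined in the context.
   Context: A state on $\mathbb{C}^n$ is a positive semidefinite $n\times n$ complex matrix of trace one. The trace norm is $\|X\|_1=\mathrm{Tr}\sqrt{X^\dagger X}$, and the trace distance of two states is $D(\rho,\sigma)=\frac12\|\rho-\sigma\|_1$. Let $\mathcal{H}_A=\mathcal{H}_B=\mathbb{C}^2$ ($A$ is the auxiliary qubit, $B$ the system qubit). For a state $\rho_{AB}$ on $\mathcal{H}_A\otimes\mathcal{H}_B$, its marginals are $\rho_A=\mathrm{Tr}_B(\rho_{AB})$ and $\rho_B=\mathrm{Tr}_A(\rho_{AB})$ (partial traces). A state on $\mathcal{H}_A\otimes\mathcal{H}_B$ is unentangled (separable) if it is a convex combination of product states $\alpha\otimes\beta$, with $\alpha$ a state on $\mathcal{H}_A$ and $\beta$ a state on $\mathcal{H}_B$. For states $\rho_B,\sigma_B$ on $\mathcal{H}_B$ (given with equal prior probabilities), the Helstrom (POVM) error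 probability is $$P_{\mathrm{error}}^{\mathrm{POVM}}(\rho_B,\sigma_B)=\tfrac12-\tfrac14\|\rho_B-\sigma_B\|_1 .$$ For $d>0$, the NPOVM error probability without system-auxiliary entanglement is $$P_{\mathrm{error}}^{\mathrm{NPOVM}}(\rho_B,\sigma_B;d)=\min\left(\tfrac12-\tfrac14\|\rho_{AB}-\sigma_{AB}\|_1\right),$$ where the minimum is over all pairs of unentangled states $\rho_{AB},\sigma_{AB}$ on $\mathcal{H}_A\otimes\mathcal{H}_B$ such that $\mathrm{Tr}_A(\rho_{AB})=\rho_B$, $\mathrm{Tr}_A(\sigma_{AB})=\sigma_B$ and $D(\rho_A,\sigma_A)\le d$, where $\rho_A=\mathrm{Tr}_B(\rho_{AB})$ and $\sigma_A=\mathrm{Tr}_B(\sigma_{AB})$. *)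

theory Defs
  imports "HOL-Analysis.Analysis"
begin

definition cinner :: "complex ^ 'n::finite \<Rightarrow> complex ^ 'n \<Rightarrow> complex" where
  "cinner u v = (\<Sum>i\<in>UNIV. cnj (u $ i) * v $ i)"

definition ketbra :: "complex ^ 'n::finite \<Rightarrow> complex ^ 'm::finite \<Rightarrow> complex ^ 'm ^ 'n" where
  "ketbra u v = (\<chi> i j. u $ i * cnj (v $ j))"

definition ctranspose :: "complex ^ 'n::finite ^ 'm::finite \<Rightarrow> complex ^ 'm ^ 'n" where
  "ctranspose A = (\<chi> i j. cnj (A $ j $ i))"

definition psd :: "complex ^ 'n::finite ^ 'n \<Rightarrow> bool" where
  "psd A \<longleftrightarrow> ctranspose A = A \<and> (\<forall>v. 0 \<le> Re (cinner v (A *v v)))"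

definition is_state :: "complex ^ 'n::finite ^ 'n \<Rightarrow> bool" where
  "is_state \<rho> \<longleftrightarrow> psd \<rho> \<and> trace \<rho> = 1"

text \<open>Every positive semidefinite matrix has exactly one positive semidefinite square root,
  so the description is proper whenever the argument is positive semidefinite.\<close>

definition psd_sqrt :: "complex ^ 'n::finite ^ 'n \<Rightarrow> complex ^ 'n ^ 'n" where
  "psd_sqrt A = (THE S. psd S \<and> S ** S = A)"

text \<open>The trace below is that of a Hermitian matrix, hence real; \<open>Re\<close> only changes its type.\<close>

definition trace_norm :: "complex ^ 'n::finite ^ 'n \<Rightarrow> real" where
  "trace_norm X = Re (trace (psd_sqrt (ctranspose X ** X)))"

definition trace_dist :: "complex ^ 'n::finite ^ 'n \<Rightarrow> complex ^ 'n ^ 'n \<Rightarrow> real" where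
  "trace_dist \<rho> \<sigma> = trace_norm (\<rho> - \<sigma>) / 2"

text \<open>The space \<open>H\<^sub>A \<otimes> H\<^sub>B\<close> has the pairs (index of \<open>A\<close>, index of \<open>B\<close>) as its basis.\<close>

definition tensor ::
  "complex ^ 'a::finite ^ 'a \<Rightarrow> complex ^ 'b::finite ^ 'b \<Rightarrow> complex ^ ('a \<times> 'b) ^ ('a \<times> 'b)" where
  "tensor \<alpha> \<beta> = (\<chi> p q. \<alpha> $ fst p $ fst q * \<beta> $ snd p $ snd q)"

definition ptrace_A :: "complex ^ ('a::finite \<times> 'b::finite) ^ ('a \<times> 'b) \<Rightarrow> complex ^ 'b ^ 'b" where
  "ptrace_A \<rho> = (\<chi> i j. \<Sum>a\<in>UNIV. \<rho> $ (a, i) $ (a, j))"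

definition ptrace_B :: "complex ^ ('a::finite \<times> 'b::finite) ^ ('a \<times> 'b) \<Rightarrow> complex ^ 'a ^ 'a" where
  "ptrace_B \<rho> = (\<chi> i j. \<Sum>b\<in>UNIV. \<rho> $ (i, b) $ (j, b))"

definition unentangled :: "complex ^ ('a::finite \<times> 'b::finite) ^ ('a \<times> 'b) \<Rightarrow> bool" where
  "unentangled \<rho> \<longleftrightarrow>
     is_state \<rho> \<and> \<rho> \<in> convex hull {tensor \<alpha> \<beta> | \<alpha> \<beta>. is_state \<alpha> \<and> is_state \<beta>}"

definition POVM_error :: "complex ^ 'n::finite ^ 'n \<Rightarrow> complex ^ 'n ^ 'n \<Rightarrow> real" where
  "POVM_error \<rho> \<sigma> = 1 / 2 - trace_norm (\<rho> - \<sigma>) / 4"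

text \<open>\<open>LEAST\<close> is a genuine minimum: it denotes an attained smallest value, not an infimum.\<close>

definition NPOVM_error :: "complex ^ 2 ^ 2 \<Rightarrow> complex ^ 2 ^ 2 \<Rightarrow> real \<Rightarrow> real" where
  "NPOVM_error \<rho>\<^sub>B \<sigma>\<^sub>B d =
     (LEAST e. \<exists>\<rho> \<sigma> :: complex ^ (2 \<times> 2) ^ (2 \<times> 2).
        unentangled \<rho> \<and> unentangled \<sigma> \<and>
        ptrace_A \<rho> = \<rho>\<^sub>B \<and> ptrace_A \<sigma> = \<sigma>\<^sub>B \<and>
        trace_dist (ptrace_B \<rho>) (ptrace_B \<sigma>) \<le> d \<and>
        e = 1 / 2 - trace_norm (\<rho> - \<sigma>) / 4)"

end

theory Submission
  imports Defs
begin

text \<open>Attach auxiliary pure states \<open>a\<close>, \<open>b\<close> with overlap \<open>sqrt (1 - d\<^sup>2)\<close>, which are at trace distance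
  exactly \<open>d\<close>. The extended states are pure product states whose overlap is that of
  \<open>\<chi>\<close> and \<open>\<delta>\<close> shrunk by this factor, and the trace norm of a difference of pure states
  strictly decreases with the overlap. As the error is defined through \<open>LEAST\<close>, comparing it with
  this pair also requires that the minimum is attained, which follows from compactness of the set
  of separable states and continuity of the trace norm.\<close>

section \<open>Inner product, adjoint and trace of complex matrices\<close>

lemma Re_cinner: "Re (cinner u v) = u \<bullet> v"
  by (simp add: cinner_def inner_vec_def inner_complex_def)

lemma cinner_self: "cinner u u = of_real ((norm u)\<^sup>2)"
proof -
  have "Im (cinner u u) = 0"
    by (simp add: cinner_def algebra_simps)
  then show ?thesis
    using Re_cinner[of u u] by (simp add: complex_eq_iff power2_norm_eq_inner)
qed

lemma cnj_cinner: "cnj (cinner u v) = cinner v u"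
  by (simp add: cinner_def mult.commute)

lemma ctranspose_ctranspose [simp]: "ctranspose (ctranspose A) = A"
  by (simp add: ctranspose_def vec_eq_iff)

lemma ctranspose_add: "ctranspose (A + B) = ctranspose A + ctranspose B"
  by (simp add: ctranspose_def vec_eq_iff)

lemma ctranspose_diff: "ctranspose (A - B) = ctranspose A - ctranspose B"
  by (simp add: ctranspose_def vec_eq_iff)

lemma ctranspose_scaleR: "ctranspose (c *\<^sub>R A) = c *\<^sub>R ctranspose A"
  by (simp add: ctranspose_def vec_eq_iff)

lemma ctranspose_mat [simp]: "ctranspose (mat 1) = mat 1"
  by (simp add: ctranspose_def mat_def vec_eq_iff)

lemma ctranspose_mult: "ctranspose (A ** B) = ctranspose B ** ctranspose A"
  by (simp add: ctranspose_def matrix_matrix_mult_def vec_eq_iff mult.commute)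

lemma ctranspose_ketbra: "ctranspose (ketbra u v) = ketbra v u"
  by (simp add: ctranspose_def ketbra_def vec_eq_iff mult.commute)

text \<open>Bilinear maps on finite-dimensional spaces are bounded, which yields distributivity,
  scaling and continuity of the product at once.\<close>

lemma bounded_bilinear_matrix_mult:
  "bounded_bilinear ((**) :: complex ^ 'n ^ 'm \<Rightarrow> complex ^ 'k ^ 'n \<Rightarrow> complex ^ 'k ^ 'm)"
  unfolding bilinear_conv_bounded_bilinear[symmetric] bilinear_def
  by (auto intro!: linearI simp: matrix_matrix_mult_def vec_eq_iff algebra_simps
      sum.distrib scaleR_sum_right)

lemmas matrix_mult_diff_left = bounded_bilinear.diff_left[OF bounded_bilinear_matrix_mult]
lemmas matrix_mult_diff_right = bounded_bilinear.diff_right[OF bounded_bilinear_matrix_mult]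
lemmas matrix_mult_add_left = bounded_bilinear.add_left[OF bounded_bilinear_matrix_mult]
lemmas matrix_mult_add_right = bounded_bilinear.add_right[OF bounded_bilinear_matrix_mult]
lemmas matrix_mult_scaleR_left = bounded_bilinear.scaleR_left[OF bounded_bilinear_matrix_mult]
lemmas matrix_mult_scaleR_right = bounded_bilinear.scaleR_right[OF bounded_bilinear_matrix_mult]
lemmas continuous_on_matrix_mult [continuous_intros] =
  bounded_bilinear.continuous_on[OF bounded_bilinear_matrix_mult]

lemma continuous_on_ctranspose [continuous_intros]:
  "continuous_on S f \<Longrightarrow> continuous_on S (\<lambda>x. ctranspose (f x))"
  unfolding ctranspose_def by (intro continuous_intros) auto

lemma continuous_on_trace [continuous_intros]:
  fixes f :: "'a::topological_space \<Rightarrow> complex ^ 'n ^ 'n"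
  shows "continuous_on S f \<Longrightarrow> continuous_on S (\<lambda>x. trace (f x))"
  unfolding trace_def by (intro continuous_intros) auto

lemma continuous_on_matrix_vector_mult [continuous_intros]:
  fixes f :: "'a::topological_space \<Rightarrow> complex ^ 'n ^ 'm"
  shows "continuous_on S f \<Longrightarrow> continuous_on S (\<lambda>x. f x *v v)"
  unfolding matrix_vector_mult_def by (intro continuous_intros) auto

lemma scaleR_matrix_vector: "(c *\<^sub>R A) *v v = c *\<^sub>R (A *v (v :: complex ^ 'n))"
  by (simp add: matrix_vector_mult_def vec_eq_iff scaleR_sum_right)

lemma matrix_vector_scaleR: "A *v (c *\<^sub>R v) = c *\<^sub>R (A *v (v :: complex ^ 'n))"
  by (simp add: matrix_vector_mult_def vec_eq_iff scaleR_sum_right)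

text \<open>The real inner product is the real part of the Hermitian one, so both have the same
  adjoint.\<close>

lemma inner_ctranspose: "u \<bullet> (A *v v) = (ctranspose A *v u) \<bullet> v"
proof -
  have "cinner u (A *v v) = cinner (ctranspose A *v u) v"
    unfolding cinner_def matrix_vector_mult_def ctranspose_def
    by (simp add: sum_distrib_left sum_distrib_right mult_ac) (rule sum.swap)
  then show ?thesis by (metis Re_cinner)
qed

lemma trace_scaleR: "trace (c *\<^sub>R A) = c *\<^sub>R trace (A :: complex ^ 'n ^ 'n)"
  by (simp add: trace_def scaleR_sum_right)

text \<open>The Euclidean norm of a nested vector is the Hilbert-Schmidt norm. This lets traces of
  squares serve as norms.\<close>

lemma trace_ctranspose_mult: "trace (ctranspose A ** A) = of_real ((norm A)\<^sup>2)"
proof -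
  have "trace (ctranspose A ** A) = (\<Sum>j\<in>UNIV. \<Sum>i\<in>UNIV. cnj (A $ i $ j) * A $ i $ j)"
    by (simp add: trace_def matrix_matrix_mult_def ctranspose_def)
  also have "\<dots> = (\<Sum>i\<in>UNIV. \<Sum>j\<in>UNIV. cnj (A $ i $ j) * A $ i $ j)"
    by (rule sum.swap)
  also have "\<dots> = (\<Sum>i\<in>UNIV. cinner (A $ i) (A $ i))"
    by (simp add: cinner_def)
  also have "\<dots> = of_real ((norm A)\<^sup>2)"
    by (simp add: cinner_self power2_norm_eq_inner inner_vec_def[of A])
  finally show ?thesis .
qed

section \<open>Square roots of positive semidefinite matrices\<close>

text \<open>Makes the library rules for the real inner product available for quadratic
  forms.\<close>

lemma psd_iff: "psd A \<longleftrightarrow> ctranspose A = A \<and> (\<forall>v. 0 \<le> v \<bullet> (A *v v))"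
  by (simp add: psd_def Re_cinner)

lemma psd_scaleR: "psd A \<Longrightarrow> 0 \<le> c \<Longrightarrow> psd (c *\<^sub>R A)"
  by (simp add: psd_iff ctranspose_scaleR scaleR_matrix_vector)

lemma psd_ctranspose_mult: "psd (ctranspose X ** X)"
proof -
  have "v \<bullet> (ctranspose X *v (X *v v)) = (X *v v) \<bullet> (X *v v)" for v
    using inner_ctranspose[of v "ctranspose X"] by simp
  then show ?thesis
    by (simp add: psd_iff ctranspose_mult flip: matrix_vector_mul_assoc)
qed

lemma closed_psd: "closed {A :: complex ^ 'n ^ 'n. psd A}"
proof -
  have "closed {A :: complex ^ 'n ^ 'n. ctranspose A = A}"
    by (intro closed_Collect_eq continuous_intros)
  moreover have "closed {A :: complex ^ 'n ^ 'n. \<forall>v. 0 \<le> v \<bullet> (A *v v)}"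
    by (intro closed_Collect_all closed_Collect_le continuous_intros)
  ultimately show ?thesis
    unfolding psd_iff by (rule closed_Collect_conj)
qed

lemma matrix_vector_bound:
  fixes A :: "complex ^ 'n ^ 'm"
  obtains c where "c > 0" "\<And>v. norm (A *v v) \<le> c * norm v"
  using bounded_linear.pos_bounded[OF matrix_vector_mul_bounded_linear[of A]]
  by (metis mult.commute)

text \<open>In operator terms, A^2 \<le> c A when c bounds the operator norm of A. It comes from
  testing positivity of A at v - A v / c.\<close>

lemma psd_norm_mult_le:
  assumes "psd A" "c > 0" "\<And>v. norm (A *v v) \<le> c * norm v"
  shows "(norm (A *v v))\<^sup>2 \<le> c * (v \<bullet> (A *v v))"
proof -
  define w where "w = A *v v"
  define u where "u = v - (1 / c) *\<^sub>R w"
  have sym: "x \<bullet> (A *v y) = (A *v x) \<bullet> y" for x y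
    using assms(1) by (metis inner_ctranspose psd_iff)
  have "w \<bullet> (A *v w) \<le> norm w * norm (A *v w)"
    by (rule norm_cauchy_schwarz)
  also have "\<dots> \<le> norm w * (c * norm w)"
    by (intro mult_left_mono assms) auto
  finally have *: "w \<bullet> (A *v w) \<le> c * (norm w)\<^sup>2"
    by (simp add: power2_eq_square mult_ac)
  have "0 \<le> u \<bullet> (A *v u)"
    using assms(1) by (simp add: psd_iff)
  also have "\<dots> = v \<bullet> w - 2 / c * (w \<bullet> w) + (1 / c)\<^sup>2 * (w \<bullet> (A *v w))"
    using \<open>c > 0\<close> sym[of v w] by (simp add: u_def matrix_vector_mult_diff_distrib
      matrix_vector_scaleR inner_diff flip: w_def) (simp add: power2_eq_square field_simps)
  also have "\<dots> \<le> v \<bullet> w - 2 / c * (w \<bullet> w) + (1 / c)\<^sup>2 * (c * (norm w)\<^sup>2)"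
    using * by (intro add_left_mono mult_left_mono) auto
  also have "\<dots> = v \<bullet> w - (norm w)\<^sup>2 / c"
    using \<open>c > 0\<close> by (simp add: power2_norm_eq_inner) (simp add: power2_eq_square field_simps)
  finally show ?thesis
    using \<open>c > 0\<close> by (simp add: w_def field_simps)
qed

lemma psd_kernel:
  assumes "psd A" "v \<bullet> (A *v v) = 0"
  shows "A *v v = 0"
proof -
  obtain c where "c > 0" "\<And>v. norm (A *v v) \<le> c * norm v"
    using matrix_vector_bound[of A] by blast
  then show ?thesis
    using psd_norm_mult_le[OF assms(1), of c v] assms(2) by simp
qed

text \<open>The j-th diagonal entry is the Hermitian quadratic form of \<open>S\<close> at column j
  of \<open>D\<close>; this reduces traces to vectors.\<close>

lemma trace_conj_column:
  "Re (trace (ctranspose D ** (S ** D))) = (\<Sum>j\<in>UNIV. column j D \<bullet> (S *v column j D))"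
  by (simp add: trace_def flip: Re_cinner)
     (simp add: cinner_def column_def ctranspose_def matrix_matrix_mult_def matrix_vector_mult_def)

lemma psd_trace_conj_nonneg: "psd S \<Longrightarrow> 0 \<le> Re (trace (ctranspose D ** (S ** D)))"
  unfolding trace_conj_column by (intro sum_nonneg) (simp add: psd_iff)

text \<open>A vanishing sum of nonnegative terms has only zero terms, so \<open>psd_kernel\<close>
  puts every column of \<open>D\<close> into the kernel of \<open>S\<close>.\<close>

lemma psd_trace_conj_zero:
  fixes S :: "complex ^ 'n ^ 'n" and D :: "complex ^ 'm ^ 'n"
  assumes "psd S" "Re (trace (ctranspose D ** (S ** D))) = 0"
  shows "S ** D = 0"
proof -
  have "column j D \<bullet> (S *v column j D) = 0" for j
    using assms sum_nonneg_eq_0_iff[of UNIV "\<lambda>j. column j D \<bullet> (S *v column j D)"]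
    unfolding trace_conj_column by (simp add: psd_iff)
  then have "S *v column j D = 0" for j
    using psd_kernel[OF assms(1)] by blast
  then have "(S *v column j D) $ i = 0" for i j
    by simp
  then show ?thesis
    by (simp add: vec_eq_iff matrix_matrix_mult_def matrix_vector_mult_def column_def)
qed

text \<open>With \<open>D = S - T\<close> the equality of squares reads \<open>S D + D T = 0\<close>; multiplying by \<open>D\<close> and
  taking the trace gives a vanishing sum of two nonnegative terms.\<close>

lemma psd_sqrt_unique:
  fixes S T :: "complex ^ 'n ^ 'n"
  assumes "psd S" "psd T" "S ** S = T ** T"
  shows "S = T"
proof -
  define D where "D = S - T"
  have h: "ctranspose D = D"
    using assms by (simp add: D_def psd_iff ctranspose_diff)
  have "S ** D + D ** T = 0"
    using assms(3) by (simp add: D_def matrix_mult_diff_left matrix_mult_diff_right)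
  then have "D ** (S ** D) + D ** (D ** T) = 0"
    by (simp flip: matrix_mult_add_right)
  then have "trace (D ** (S ** D)) + trace (D ** (D ** T)) = 0"
    by (metis trace_add trace_0 mat_0)
  \<comment> \<open>Cyclicity of the trace brings the second term into conjugated form, where
    positivity of \<open>T\<close> applies.\<close>
  moreover have "trace (D ** (D ** T)) = trace (D ** (T ** D))"
    by (metis matrix_mul_assoc trace_mul_sym)
  ultimately have "Re (trace (ctranspose D ** (S ** D))) + Re (trace (ctranspose D ** (T ** D))) = 0"
    by (metis h plus_complex.sel(1) zero_complex.sel(1))
  then have "Re (trace (ctranspose D ** (S ** D))) = 0" "Re (trace (ctranspose D ** (T ** D))) = 0"
    using psd_trace_conj_nonneg[OF assms(1), of D] psd_trace_conj_nonneg[OF assms(2), of D]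
    by linarith+
  then have "S ** D = 0" "T ** D = 0"
    using psd_trace_conj_zero assms by blast+
  \<comment> \<open>D^2 = S D - T D, and for the Hermitian \<open>D\<close> the trace of D^2 is the
    squared norm.\<close>
  then have "D ** D = 0"
    by (metis D_def matrix_mult_diff_left diff_self)
  then have "norm D = 0"
    using trace_ctranspose_mult[of D] by (simp add: h trace_def)
  then show ?thesis
    by (simp add: D_def)
qed

text \<open>A fixed point \<open>Y\<close> of \<open>Y \<mapsto> (I - A + Y\<^sup>2) / 2\<close> satisfies \<open>(I - Y)\<^sup>2 = A\<close>, and Brouwer's theorem
  provides one among the Hermitian contractions.\<close>

lemma psd_contraction_sqrt:
  fixes A :: "complex ^ 'n ^ 'n"
  assumes "psd A" "\<And>v. norm (A *v v) \<le> norm v"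
  shows "\<exists>S. psd S \<and> S ** S = A"
proof -
  define K where "K = {Y :: complex ^ 'n ^ 'n. ctranspose Y = Y \<and> (\<forall>v. norm (Y *v v) \<le> norm v)}"
  define B where "B = mat 1 - A"
  define f where "f Y = (1/2) *\<^sub>R (B + Y ** Y)" for Y
  have hB: "ctranspose B = B"
    using assms by (simp add: B_def psd_iff ctranspose_diff)
  \<comment> \<open>The bound \<open>psd_norm_mult_le\<close> with c = 1 lets the cross term
    outweigh the squared norm of A v.\<close>
  have nB: "norm (B *v v) \<le> norm v" for v
  proof -
    have "(norm (B *v v))\<^sup>2 = (norm v)\<^sup>2 - 2 * (v \<bullet> (A *v v)) + (norm (A *v v))\<^sup>2"
      by (simp add: B_def matrix_vector_mult_diff_rdistrib power2_norm_eq_inner inner_diff inner_commute)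
    also have "\<dots> \<le> (norm v)\<^sup>2"
      using psd_norm_mult_le[OF assms(1), of 1 v] assms(2) spec[OF conjunct2[OF assms(1)[unfolded psd_iff]], of v]
      by simp
    finally show ?thesis by (rule power2_le_imp_le) simp
  qed
  have "closed K"
  proof -
    have "closed {Y :: complex ^ 'n ^ 'n. ctranspose Y = Y}"
      by (intro closed_Collect_eq continuous_intros)
    moreover have "closed {Y :: complex ^ 'n ^ 'n. \<forall>v. norm (Y *v v) \<le> norm v}"
      by (intro closed_Collect_all closed_Collect_le continuous_intros)
    ultimately show ?thesis
      unfolding K_def by (rule closed_Collect_conj)
  qed
  moreover have "bounded K"
  proof -
    \<comment> \<open>Each entry of a contraction is a coordinate of the image of a basis vector,
      hence of modulus at most one.\<close>
    have "norm Y \<le> (\<Sum>i\<in>(UNIV::'n set). \<Sum>j\<in>(UNIV::'n set). 1)" if "Y \<in> K" for Y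
    proof -
      have "norm (Y $ i $ j) \<le> 1" for i j
      proof -
        have "Y $ i $ j = (Y *v axis j 1) $ i"
          by (simp add: matrix_vector_mult_def axis_def if_distrib cong: if_cong)
        also have "norm \<dots> \<le> norm (Y *v axis j 1)"
          by (rule Finite_Cartesian_Product.norm_nth_le)
        also have "\<dots> \<le> norm (axis j (1::complex) :: complex ^ 'n)"
          using that unfolding K_def by blast
        finally show ?thesis by simp
      qed
      then have "(\<Sum>i\<in>UNIV. \<Sum>j\<in>UNIV. norm (Y $ i $ j)) \<le> (\<Sum>i\<in>(UNIV::'n set). \<Sum>j\<in>(UNIV::'n set). 1)"
        by (intro sum_mono)
      moreover have "norm Y \<le> (\<Sum>i\<in>UNIV. norm (Y $ i))"
        by (simp add: norm_vec_def L2_set_le_sum)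
      moreover have "(\<Sum>i\<in>UNIV. norm (Y $ i)) \<le> (\<Sum>i\<in>UNIV. \<Sum>j\<in>UNIV. norm (Y $ i $ j))"
        by (intro sum_mono) (simp add: norm_vec_def L2_set_le_sum)
      ultimately show ?thesis by linarith
    qed
    then show ?thesis by (auto simp: bounded_iff)
  qed
  ultimately have "compact K"
    by (simp add: compact_eq_bounded_closed)
  moreover have "convex K"
  proof (rule convexI)
    fix X Y and u v :: real
    assume *: "X \<in> K" "Y \<in> K" "0 \<le> u" "0 \<le> v" "u + v = 1"
    have "norm ((u *\<^sub>R X + v *\<^sub>R Y) *v x) \<le> norm x" for x
    proof -
      have "norm ((u *\<^sub>R X + v *\<^sub>R Y) *v x) \<le> u * norm (X *v x) + v * norm (Y *v x)"
        using norm_triangle_ineq[of "u *\<^sub>R (X *v x)" "v *\<^sub>R (Y *v x)"] *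
        by (simp add: matrix_vector_mult_add_rdistrib scaleR_matrix_vector)
      also have "\<dots> \<le> u * norm x + v * norm x"
        using * by (intro add_mono mult_left_mono) (auto simp: K_def)
      finally show ?thesis
        using * by (simp flip: distrib_right)
    qed
    then show "u *\<^sub>R X + v *\<^sub>R Y \<in> K"
      using * by (simp add: K_def ctranspose_add ctranspose_scaleR)
  qed
  moreover have "mat 1 \<in> K"
    by (simp add: K_def)
  then have "K \<noteq> {}" by blast
  moreover have "continuous_on K f"
    unfolding f_def by (intro continuous_intros)
  moreover have "f \<in> K \<rightarrow> K"
  proof
    fix Y assume "Y \<in> K"
    then have Y: "ctranspose Y = Y" "\<And>v. norm (Y *v v) \<le> norm v"
      by (auto simp: K_def)
    have "norm (f Y *v v) \<le> norm v" for v
    proof -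
      have "norm (Y *v (Y *v v)) \<le> norm v"
        using Y(2) order_trans by blast
      then show ?thesis
        using nB[of v] norm_triangle_ineq[of "B *v v" "Y *v (Y *v v)"]
        by (simp add: f_def scaleR_matrix_vector matrix_vector_mult_add_rdistrib matrix_vector_mul_assoc)
    qed
    then show "f Y \<in> K"
      using Y by (simp add: K_def f_def hB ctranspose_scaleR ctranspose_add ctranspose_mult)
  qed
  ultimately obtain Y where Y: "Y \<in> K" "f Y = Y"
    by (rule brouwer)
  define S where "S = mat 1 - Y"
  \<comment> \<open>By Cauchy-Schwarz the quadratic form of a contraction is at most that of the
    identity.\<close>
  have "psd S"
  proof -
    have "v \<bullet> (Y *v v) \<le> v \<bullet> v" for v
    proof -
      have "v \<bullet> (Y *v v) \<le> norm v * norm (Y *v v)"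
        by (rule norm_cauchy_schwarz)
      also have "\<dots> \<le> norm v * norm v"
        using Y by (intro mult_left_mono) (auto simp: K_def)
      finally show ?thesis
        by (simp add: norm_eq_sqrt_inner)
    qed
    then show ?thesis
      using Y by (simp add: S_def psd_iff K_def ctranspose_diff matrix_vector_mult_diff_rdistrib inner_diff)
  qed
  moreover have "S ** S = A"
  proof -
    have "B + Y ** Y = 2 *\<^sub>R f Y"
      by (simp add: f_def)
    also have "\<dots> = Y + Y"
      using Y by (simp add: scaleR_2)
    finally show ?thesis
      by (simp add: S_def B_def matrix_mult_diff_left matrix_mult_diff_right algebra_simps)
  qed
  ultimately show ?thesis by blast
qed

text \<open>Dividing by a norm bound c gives a contraction; its root is then multiplied by the
  square root of c.\<close>

lemma psd_sqrt_exists: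
  assumes "psd A"
  shows "\<exists>S. psd S \<and> S ** S = A"
proof -
  obtain c where c: "c > 0" "\<And>v. norm (A *v v) \<le> c * norm v"
    using matrix_vector_bound[of A] by blast
  have "\<exists>S. psd S \<and> S ** S = (1 / c) *\<^sub>R A"
    using c assms
    by (intro psd_contraction_sqrt psd_scaleR) (auto simp: scaleR_matrix_vector field_simps)
  then obtain S where S: "psd S" "S ** S = (1 / c) *\<^sub>R A" by blast
  have "psd (sqrt c *\<^sub>R S)" "(sqrt c *\<^sub>R S) ** (sqrt c *\<^sub>R S) = A"
    using S c by (auto simp: psd_scaleR matrix_mult_scaleR_left matrix_mult_scaleR_right)
  then show ?thesis by blast
qed

lemma psd_sqrt_eqI: "psd S \<Longrightarrow> S ** S = A \<Longrightarrow> psd_sqrt A = S"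
  unfolding psd_sqrt_def by (rule the_equality) (auto intro: psd_sqrt_unique)

lemma psd_sqrt:
  assumes "psd A"
  shows "psd (psd_sqrt A)" "psd_sqrt A ** psd_sqrt A = A"
proof -
  obtain S where S: "psd S" "S ** S = A"
    using psd_sqrt_exists[OF assms] by blast
  show "psd (psd_sqrt A)" "psd_sqrt A ** psd_sqrt A = A"
    unfolding psd_sqrt_eqI[OF S] by (rule S)+
qed

lemma norm_square_trace: "(norm A)\<^sup>2 = Re (trace (ctranspose A ** A))"
  unfolding trace_ctranspose_mult by simp

lemma norm_psd_square: "psd S \<Longrightarrow> (norm S)\<^sup>2 = Re (trace (S ** S))"
  by (simp add: norm_square_trace psd_iff)

section \<open>Continuity of the trace norm and compactness of the set of states\<close>

text \<open>By uniqueness of the root, the graph of X \<mapsto>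
  \<open>psd_sqrt (ctranspose X ** X)\<close> is cut out by closed conditions. The root has the same
  norm as X, so on a ball its values stay in a compact set, and a closed graph then implies
  continuity.\<close>

lemma continuous_on_trace_norm: "continuous_on UNIV (trace_norm :: complex ^ 'n ^ 'n \<Rightarrow> real)"
proof -
  define g :: "complex ^ 'n ^ 'n \<Rightarrow> complex ^ 'n ^ 'n" where "g X = psd_sqrt (ctranspose X ** X)" for X
  have g: "psd (g X)" "g X ** g X = ctranspose X ** X" for X
    unfolding g_def by (rule psd_sqrt[OF psd_ctranspose_mult])+
  have norm_g: "norm (g X) = norm X" for X
  proof -
    have "(norm (g X))\<^sup>2 = (norm X)\<^sup>2"
      unfolding norm_psd_square[OF g(1)] g(2) norm_square_trace[of X] ..
    then show ?thesis
      by simp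
  qed
  have "continuous_on (cball 0 R) g" for R
  proof (rule continuous_from_closed_graph[of "cball 0 R"])
    have "(\<lambda>X. (X, g X)) ` cball 0 R
      = {p. fst p \<in> cball 0 R \<and> psd (snd p) \<and> snd p ** snd p = ctranspose (fst p) ** fst p}"
    proof -
      have "S = g X \<longleftrightarrow> psd S \<and> S ** S = ctranspose X ** X" for S X
        using g psd_sqrt_unique by metis
      then show ?thesis
        by (auto simp: image_iff g)
    qed
    moreover have "closed \<dots>"
    proof (intro closed_Collect_conj)
      show "closed {p :: (complex ^ 'n ^ 'n) \<times> (complex ^ 'n ^ 'n). fst p \<in> cball 0 R}"
        using closed_vimage_fst[OF closed_cball, of 0 R] by (simp only: vimage_def)
      show "closed {p :: (complex ^ 'n ^ 'n) \<times> (complex ^ 'n ^ 'n). psd (snd p)}"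
        using closed_vimage_snd[OF closed_psd] by (simp add: vimage_def)
      show "closed {p :: (complex ^ 'n ^ 'n) \<times> (complex ^ 'n ^ 'n).
          snd p ** snd p = ctranspose (fst p) ** fst p}"
        by (intro closed_Collect_eq continuous_intros)
    qed
    ultimately show "closed ((\<lambda>X. (X, g X)) ` cball 0 R)" by simp
  qed (auto simp: norm_g)
  \<comment> \<open>Every matrix is interior to some ball, so continuity on balls gives continuity
    everywhere.\<close>
  then have "continuous_on (ball 0 R) g" for R
    by (meson ball_subset_cball continuous_on_subset)
  then have "isCont g X" for X
    by (rule continuous_on_interior[of "ball 0 (norm X + 1)"]) simp
  then have "continuous_on UNIV g"
    by (simp add: continuous_at_imp_continuous_on)
  then have "continuous_on UNIV (\<lambda>X. Re (trace (g X)))"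
    by (intro continuous_intros)
  then show ?thesis
    by (simp add: g_def trace_norm_def[abs_def])
qed

lemmas continuous_on_trace_norm' [continuous_intros] =
  continuous_on_compose2[OF continuous_on_trace_norm _ subset_UNIV]

text \<open>The trace of S^2 is the squared norm of a Hermitian S, so squaring maps the positive
  semidefinite part of the unit sphere onto the states.\<close>

lemma compact_states: "compact {\<rho> :: complex ^ 'n ^ 'n. is_state \<rho>}"
proof -
  define K where "K = {S :: complex ^ 'n ^ 'n. psd S} \<inter> sphere 0 1"
  have "{\<rho>. is_state \<rho>} = (\<lambda>S. S ** S) ` K"
  proof (intro equalityI subsetI)
    fix \<rho> :: "complex ^ 'n ^ 'n" assume "\<rho> \<in> {\<rho>. is_state \<rho>}"
    then have "psd \<rho>" "trace \<rho> = 1" by (auto simp: is_state_def)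
    note S = psd_sqrt[OF \<open>psd \<rho>\<close>]
    have "(norm (psd_sqrt \<rho>))\<^sup>2 = 1"
      using \<open>trace \<rho> = 1\<close> by (simp add: norm_psd_square S)
    then have "norm (psd_sqrt \<rho>) = 1"
      by (smt (verit) norm_ge_zero power2_eq_1_iff)
    then show "\<rho> \<in> (\<lambda>S. S ** S) ` K"
      using S by (intro image_eqI[of _ _ "psd_sqrt \<rho>"]) (auto simp: K_def)
  next
    fix \<rho> assume "\<rho> \<in> (\<lambda>S. S ** S) ` K"
    then obtain S where S: "psd S" "norm S = 1" "\<rho> = S ** S" by (auto simp: K_def)
    then show "\<rho> \<in> {\<rho>. is_state \<rho>}"
      using trace_ctranspose_mult[of S] psd_ctranspose_mult[of S] by (simp add: is_state_def psd_iff)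
  qed
  moreover have "compact K"
    unfolding K_def by (intro closed_Int_compact closed_psd compact_sphere)
  then have "compact ((\<lambda>S. S ** S) ` K)"
    by (intro compact_continuous_image continuous_intros)
  ultimately show ?thesis by simp
qed

text \<open>Product states form a continuous image of a compact set, and convex hulls of compact
  sets are compact in finite dimension.\<close>

lemma compact_unentangled:
  "compact {\<rho> :: complex ^ ('a::finite \<times> 'b::finite) ^ ('a \<times> 'b). unentangled \<rho>}"
proof -
  let ?T = "{tensor \<alpha> \<beta> | (\<alpha> :: complex ^ 'a ^ 'a) (\<beta> :: complex ^ 'b ^ 'b). is_state \<alpha> \<and> is_state \<beta>}"
  have "?T = (\<lambda>p. tensor (fst p) (snd p)) ` ({\<alpha>. is_state \<alpha>} \<times> {\<beta>. is_state \<beta>})"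
    by force
  moreover have "compact \<dots>"
    by (intro compact_continuous_image compact_Times compact_states)
       (unfold tensor_def, intro continuous_intros)
  ultimately have "compact (convex hull ?T)"
    by (simp add: compact_convex_hull)
  then have "compact ({\<rho>. is_state \<rho>} \<inter> convex hull ?T)"
    by (intro compact_Int compact_states)
  then show ?thesis
    by (simp add: unentangled_def Int_def)
qed

section \<open>Pure states\<close>

lemma ketbra_mult: "ketbra a b ** ketbra c e = ketbra (cinner b c *s a) e"
  by (simp add: ketbra_def matrix_matrix_mult_def cinner_def vec_eq_iff
      sum_distrib_left sum_distrib_right mult_ac)

lemma ketbra_scaleR: "ketbra (complex_of_real c *s a) b = c *\<^sub>R ketbra a b"
  by (simp add: ketbra_def vec_eq_iff) (simp add: scaleR_conv_of_real)

lemma cinner_scale_right: "cinner u (c *s v) = c * cinner u v"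
  by (simp add: cinner_def sum_distrib_left mult_ac)

lemma trace_ketbra: "trace (ketbra u v) = cinner v u"
  by (simp add: trace_def ketbra_def cinner_def mult.commute)

lemma ketbra_self_idem:
  "norm u = 1 \<Longrightarrow> ketbra u u ** ketbra u u = ketbra u u"
  by (simp add: ketbra_mult cinner_self)

lemma is_state_ketbra: "norm u = 1 \<Longrightarrow> is_state (ketbra u u)"
  using psd_ctranspose_mult[of "ketbra u u"]
  by (simp add: is_state_def trace_ketbra cinner_self ctranspose_ketbra ketbra_self_idem)

lemma cinner_mult_swap: "cinner a b * cinner b a = of_real ((cmod (cinner a b))\<^sup>2)"
  by (metis cnj_cinner complex_norm_square)

text \<open>Compressing to a one-dimensional range leaves a scalar multiple of its projection; the
  scalar is the transition probability.\<close>

lemma ketbra_sandwich: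
  "ketbra a a ** ketbra b b ** ketbra a a = (cmod (cinner a b))\<^sup>2 *\<^sub>R ketbra a a"
  using cinner_mult_swap[of a b, unfolded mult.commute[of "cinner a b"]]
  by (simp add: ketbra_mult cinner_scale_right del: of_real_power flip: ketbra_scaleR)

text \<open>The difference \<open>X\<close> of the two projections satisfies \<open>X\<^sup>3 = t X\<close> with
  \<open>t = 1 - |\<langle>a|b\<rangle>|\<^sup>2\<close>, so that the square root of \<open>X\<^sup>2\<close> is \<open>X\<^sup>2\<close> divided by the square root of
  \<open>t\<close>; for \<open>t = 0\<close> the division by zero is harmless because then \<open>X = 0\<close>.\<close>

lemma trace_norm_pure_diff:
  fixes a b :: "complex ^ 'n"
  assumes "norm a = 1" "norm b = 1"
  shows "trace_norm (ketbra a a - ketbra b b) = 2 * sqrt (1 - (cmod (cinner a b))\<^sup>2)"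
proof -
  define P where "P = ketbra a a"
  define Q where "Q = ketbra b b"
  define X where "X = P - Q"
  define t where "t = 1 - (cmod (cinner a b))\<^sup>2"
  define S where "S = (1 / sqrt t) *\<^sub>R (X ** X)"
  have PQ: "P ** P = P" "Q ** Q = Q" "P ** Q ** P = (1 - t) *\<^sub>R P" "Q ** P ** Q = (1 - t) *\<^sub>R Q"
    using ketbra_sandwich[of b a] cnj_cinner[of a b, symmetric] assms
    by (auto simp: P_def Q_def t_def ketbra_self_idem ketbra_sandwich)
  have hX: "ctranspose X = X"
    by (simp add: X_def P_def Q_def ctranspose_diff ctranspose_ketbra)
  have XX: "X ** X = P + Q - P ** Q - Q ** P"
    by (simp add: X_def matrix_mult_diff_left matrix_mult_diff_right PQ)
  have XXX: "X ** X ** X = t *\<^sub>R X"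
  proof -
    have "P ** Q ** Q = P ** Q" "Q ** P ** P = Q ** P"
      by (simp_all add: PQ flip: matrix_mul_assoc)
    then have "X ** X ** X = P - Q - P ** Q ** P + Q ** P ** Q"
      unfolding XX by (simp add: X_def matrix_mult_diff_left matrix_mult_diff_right
          matrix_mult_add_left matrix_mult_add_right PQ(1,2))
    then show ?thesis
      by (simp add: PQ X_def algebra_simps)
  qed
  \<comment> \<open>Both projections have trace one and each mixed product has trace 1 - t, so the
    total is 2 - 2 (1 - t).\<close>
  have trXX: "trace (X ** X) = of_real (2 * t)"
  proof -
    have "trace (P ** Q) = cinner a b * cinner b a"
      by (simp add: P_def Q_def ketbra_mult trace_ketbra cinner_scale_right)
    also have "\<dots> = of_real (1 - t)"
      by (simp add: t_def cinner_mult_swap)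
    finally have "trace (P ** Q) = of_real (1 - t)" .
    then show ?thesis
      using trace_mul_sym[of P Q] assms
      by (simp add: XX trace_add trace_sub) (simp add: P_def Q_def trace_ketbra cinner_self)
  qed
  then have nX: "(norm X)\<^sup>2 = 2 * t"
    by (simp add: norm_square_trace hX)
  \<comment> \<open>Nonnegativity is read off the squared norm of \<open>X\<close>, in place of a
    complex Cauchy-Schwarz inequality.\<close>
  have "t \<ge> 0"
    using zero_le_power2[of "norm X"] unfolding nX by simp
  have "psd S"
    using psd_ctranspose_mult[of X] \<open>t \<ge> 0\<close> by (simp add: S_def hX psd_scaleR)
  moreover have "S ** S = ctranspose X ** X"
  proof (cases "t = 0")
    case True
    then show ?thesis using nX by (simp add: S_def matrix_mult_scaleR_left)
  next
    case False
    \<comment> \<open>Multiplying X^3 = t X by \<open>X\<close> gives X^4 = t X^2, which is what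
      squaring \<open>S\<close> requires.\<close>
    have "X ** X ** (X ** X) = t *\<^sub>R (X ** X)"
      by (metis XXX matrix_mul_assoc matrix_mult_scaleR_left)
    then show ?thesis
      using False \<open>t \<ge> 0\<close> by (simp add: S_def hX matrix_mult_scaleR_left matrix_mult_scaleR_right)
  qed
  ultimately have "trace_norm X = Re (trace S)"
    by (simp add: trace_norm_def psd_sqrt_eqI)
  also have "\<dots> = 2 * (t / sqrt t)"
    by (simp add: S_def trace_scaleR trXX)
  also have "\<dots> = 2 * sqrt t"
    using \<open>t \<ge> 0\<close> by (simp add: real_div_sqrt)
  finally show ?thesis
    by (simp add: X_def P_def Q_def t_def)
qed

section \<open>Product vectors and product states\<close>

definition tensor_vec :: "complex ^ 'a::finite \<Rightarrow> complex ^ 'b::finite \<Rightarrow> complex ^ ('a \<times> 'b)" where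
  "tensor_vec u v = (\<chi> p. u $ fst p * v $ snd p)"

text \<open>Products of pure states are again pure, so \<open>trace_norm_pure_diff\<close> applies
  on the joint space.\<close>

lemma tensor_ketbra: "tensor (ketbra a a) (ketbra u u) = ketbra (tensor_vec a u) (tensor_vec a u)"
  by (simp add: tensor_def ketbra_def tensor_vec_def vec_eq_iff mult_ac)

lemma cinner_tensor_vec: "cinner (tensor_vec a u) (tensor_vec b v) = cinner a b * cinner u v"
proof -
  have "cinner (tensor_vec a u) (tensor_vec b v)
    = (\<Sum>i\<in>UNIV. \<Sum>j\<in>UNIV. cnj (a $ i * u $ j) * (b $ i * v $ j))"
    unfolding sum.cartesian_product UNIV_Times_UNIV
    by (simp add: cinner_def tensor_vec_def split_def)
  then show ?thesis
    by (simp add: cinner_def sum_product mult_ac)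
qed

lemma norm_tensor_vec: "norm (tensor_vec a u) = norm a * norm u"
proof -
  have "(norm (tensor_vec a u))\<^sup>2 = Re (cinner (tensor_vec a u) (tensor_vec a u))"
    by (simp add: cinner_self)
  also have "\<dots> = (norm a * norm u)\<^sup>2"
    unfolding cinner_tensor_vec unfolding cinner_self
    by (simp only: of_real_mult[symmetric] Re_complex_of_real power_mult_distrib)
  finally show ?thesis
    by (simp add: power2_eq_iff_nonneg)
qed

lemma ptrace_A_tensor: "trace \<alpha> = 1 \<Longrightarrow> ptrace_A (tensor \<alpha> \<beta>) = \<beta>"
  by (simp add: ptrace_A_def tensor_def trace_def vec_eq_iff flip: sum_distrib_right)

lemma ptrace_B_tensor: "trace \<beta> = 1 \<Longrightarrow> ptrace_B (tensor \<alpha> \<beta>) = \<alpha>"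
  by (simp add: ptrace_B_def tensor_def trace_def vec_eq_iff flip: sum_distrib_left)

lemma unentangled_tensor_ketbra:
  assumes "norm a = 1" "norm u = 1"
  shows "unentangled (tensor (ketbra a a) (ketbra u u))"
proof -
  have "is_state (tensor (ketbra a a) (ketbra u u))"
    using assms by (simp add: tensor_ketbra is_state_ketbra norm_tensor_vec)
  then show ?thesis
    unfolding unentangled_def
    using is_state_ketbra[OF assms(1)] is_state_ketbra[OF assms(2)] by (blast intro: hull_inc)
qed

section \<open>The minimal error\<close>

text \<open>The marginals and their trace distance are continuous, so the constraints cut a closed
  subset out of the compact set of separable pairs.\<close>

lemma compact_feasible_pairs:
  "compact {p :: (complex ^ (2 \<times> 2) ^ (2 \<times> 2)) \<times> (complex ^ (2 \<times> 2) ^ (2 \<times> 2)).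
     unentangled (fst p) \<and> unentangled (snd p) \<and>
     ptrace_A (fst p) = \<rho>\<^sub>B \<and> ptrace_A (snd p) = \<sigma>\<^sub>B \<and>
     trace_dist (ptrace_B (fst p)) (ptrace_B (snd p)) \<le> d}"
proof -
  let ?U = "{\<rho> :: complex ^ (2 \<times> 2) ^ (2 \<times> 2). unentangled \<rho>}"
  let ?C = "{p :: (complex ^ (2 \<times> 2) ^ (2 \<times> 2)) \<times> (complex ^ (2 \<times> 2) ^ (2 \<times> 2)).
     ptrace_A (fst p) = \<rho>\<^sub>B \<and> ptrace_A (snd p) = \<sigma>\<^sub>B \<and>
     trace_dist (ptrace_B (fst p)) (ptrace_B (snd p)) \<le> d}"
  have "closed ?C"
  proof -
    have "continuous_on UNIV (\<lambda>p :: (complex ^ (2 \<times> 2) ^ (2 \<times> 2)) \<times> (complex ^ (2 \<times> 2) ^ (2 \<times> 2)).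
        ptrace_B (fst p) - ptrace_B (snd p))"
      unfolding ptrace_B_def by (intro continuous_intros)
    then have "continuous_on UNIV (\<lambda>p :: (complex ^ (2 \<times> 2) ^ (2 \<times> 2)) \<times> (complex ^ (2 \<times> 2) ^ (2 \<times> 2)).
        trace_dist (ptrace_B (fst p)) (ptrace_B (snd p)))"
      unfolding trace_dist_def
      by (intro continuous_on_divide continuous_on_const continuous_on_trace_norm') auto
    then show ?thesis
      unfolding ptrace_A_def
      by (intro closed_Collect_conj closed_Collect_eq closed_Collect_le continuous_intros)
  qed
  then have "compact (?C \<inter> ?U \<times> ?U)"
    by (intro closed_Int_compact compact_Times compact_unentangled)
  moreover have "?C \<inter> ?U \<times> ?U = {p. unentangled (fst p) \<and> unentangled (snd p) \<and>
     ptrace_A (fst p) = \<rho>\<^sub>B \<and> ptrace_A (snd p) = \<sigma>\<^sub>B \<and>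
     trace_dist (ptrace_B (fst p)) (ptrace_B (snd p)) \<le> d}"
    by auto
  ultimately show ?thesis by simp
qed

text \<open>The given pair is feasible for its own marginals, so the continuous error attains a
  minimum on a nonempty compact set, and \<open>LEAST\<close> denotes that minimum.\<close>

lemma NPOVM_error_le:
  fixes \<rho> \<sigma> :: "complex ^ (2 \<times> 2) ^ (2 \<times> 2)"
  assumes "unentangled \<rho>" "unentangled \<sigma>" "trace_dist (ptrace_B \<rho>) (ptrace_B \<sigma>) \<le> d"
  shows "NPOVM_error (ptrace_A \<rho>) (ptrace_A \<sigma>) d \<le> 1 / 2 - trace_norm (\<rho> - \<sigma>) / 4"
proof -
  let ?F = "{p :: (complex ^ (2 \<times> 2) ^ (2 \<times> 2)) \<times> (complex ^ (2 \<times> 2) ^ (2 \<times> 2)).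
     unentangled (fst p) \<and> unentangled (snd p) \<and>
     ptrace_A (fst p) = ptrace_A \<rho> \<and> ptrace_A (snd p) = ptrace_A \<sigma> \<and>
     trace_dist (ptrace_B (fst p)) (ptrace_B (snd p)) \<le> d}"
  let ?e = "\<lambda>p. 1 / 2 - trace_norm (fst p - snd p) / 4"
  have "(\<rho>, \<sigma>) \<in> ?F"
    using assms by simp
  moreover have "continuous_on ?F ?e"
    by (intro continuous_intros) auto
  ultimately obtain p where p: "p \<in> ?F" "\<And>q. q \<in> ?F \<Longrightarrow> ?e p \<le> ?e q"
    using continuous_attains_inf[OF compact_feasible_pairs, of "ptrace_A \<rho>" "ptrace_A \<sigma>" d ?e] by blast
  have "NPOVM_error (ptrace_A \<rho>) (ptrace_A \<sigma>) d = ?e p"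
    unfolding NPOVM_error_def
  proof (rule Least_equality)
    show "\<exists>\<rho>' \<sigma>' :: complex ^ (2 \<times> 2) ^ (2 \<times> 2). unentangled \<rho>' \<and> unentangled \<sigma>' \<and> ptrace_A \<rho>' = ptrace_A \<rho> \<and>
        ptrace_A \<sigma>' = ptrace_A \<sigma> \<and> trace_dist (ptrace_B \<rho>') (ptrace_B \<sigma>') \<le> d \<and>
        ?e p = 1 / 2 - trace_norm (\<rho>' - \<sigma>') / 4"
      using p(1) by (intro exI[of _ "fst p"] exI[of _ "snd p"]) simp
  next
    fix e
    assume "\<exists>\<rho>' \<sigma>' :: complex ^ (2 \<times> 2) ^ (2 \<times> 2). unentangled \<rho>' \<and> unentangled \<sigma>' \<and> ptrace_A \<rho>' = ptrace_A \<rho> \<and>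
        ptrace_A \<sigma>' = ptrace_A \<sigma> \<and> trace_dist (ptrace_B \<rho>') (ptrace_B \<sigma>') \<le> d \<and>
        e = 1 / 2 - trace_norm (\<rho>' - \<sigma>') / 4"
    then obtain \<rho>' \<sigma>' where "(\<rho>', \<sigma>') \<in> ?F" "e = ?e (\<rho>', \<sigma>')"
      by auto
    then show "?e p \<le> e"
      using p(2) by blast
  qed
  then show ?thesis
    using p(2)[OF \<open>(\<rho>, \<sigma>) \<in> ?F\<close>] by simp
qed

theorem theorem1:
  fixes chi delta :: "complex ^ 2" and d :: real
  assumes "norm chi = 1" and "norm delta = 1"
    and "cinner chi delta \<noteq> 0"
    and "0 < d" and "d < 1"
  shows "NPOVM_error (ketbra chi chi) (ketbra delta delta) d
         < POVM_error (ketbra chi chi) (ketbra delta delta)"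
proof -
  define a :: "complex ^ 2" where "a = vector [1, 0]"
  define b :: "complex ^ 2" where "b = vector [of_real (sqrt (1 - d\<^sup>2)), of_real d]"
  have d2: "0 < d\<^sup>2" "d\<^sup>2 < 1"
    using assms by (auto simp: power_less_one_iff)
  have a: "norm a = 1"
    by (simp add: a_def norm_vec_def L2_set_def sum_2)
  have b: "norm b = 1"
    using d2 by (simp add: b_def norm_vec_def L2_set_def sum_2)
  have ab: "cmod (cinner a b) = sqrt (1 - d\<^sup>2)"
    using d2 by (simp add: a_def b_def cinner_def sum_2)
  let ?\<rho> = "tensor (ketbra a a) (ketbra chi chi)"
  let ?\<sigma> = "tensor (ketbra b b) (ketbra delta delta)"
  define f where "f = (cmod (cinner chi delta))\<^sup>2"
  have "0 < f"
    using assms by (simp add: f_def)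
  have tr: "trace (ketbra u u) = 1" if "norm u = 1" for u :: "complex ^ 2"
    using that by (simp add: trace_ketbra cinner_self)
  \<comment> \<open>The distance is sqrt (1 - (1 - d^2)), so the auxiliary constraint holds with
    equality.\<close>
  have "trace_dist (ketbra a a) (ketbra b b) = d"
    using a b ab d2 assms by (simp add: trace_dist_def trace_norm_pure_diff)
  then have "NPOVM_error (ketbra chi chi) (ketbra delta delta) d \<le> 1 / 2 - trace_norm (?\<rho> - ?\<sigma>) / 4"
    using NPOVM_error_le[of ?\<rho> ?\<sigma> d] assms a b
    by (simp add: unentangled_tensor_ketbra ptrace_A_tensor ptrace_B_tensor tr)
  \<comment> \<open>Overlaps of product vectors multiply, so the squared overlap is (1 - d^2)
    f.\<close>
  also have "trace_norm (?\<rho> - ?\<sigma>) = 2 * sqrt (1 - (1 - d\<^sup>2) * f)"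
    using assms a b ab d2
    by (simp add: tensor_ketbra trace_norm_pure_diff norm_tensor_vec cinner_tensor_vec
        norm_mult power_mult_distrib f_def)
  \<comment> \<open>Non-orthogonality gives f > 0, hence (1 - d^2) f < f strictly for every positive
    d.\<close>
  also have "1 / 2 - 2 * sqrt (1 - (1 - d\<^sup>2) * f) / 4 < 1 / 2 - 2 * sqrt (1 - f) / 4"
    using \<open>0 < f\<close> d2 by (simp add: algebra_simps)
  also have "\<dots> = POVM_error (ketbra chi chi) (ketbra delta delta)"
    using assms by (simp add: POVM_error_def trace_norm_pure_diff f_def)
  finally show ?thesis .
qed

end
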